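(* Let $E,J,R,Q\in\mathbb{R}^{n\times n}$ with $J=-J^T$, $R=R^T\ge0$, $Q^TE=E^TQ\ge0$ and $\ker Q\subseteq\ker E$. Then: (a) If the pencil $sE-Q$ is regular, then $Q$ is invertible. (b) If $Q$ is invertible, then $[E,(J-R)Q]$ is stable if and only if $\ker J\cap\ker R\cap(Q\ker E)=\{0\}$.
   Context: A pencil $sE-A$ is regular if $\det(sE-A)$ is not the zero polynomial. For $E,A\in\mathbb{R}^{n\times n}$, $[E,A]$ is stable if every $x\in C^\infty(\mathbb{R},\mathbb{R}^n)$ with $\tfrac{d}{dt}Ex=Ax$ is bounded on $[0,\infty)$. $Q\ker E=\{Qx: Ex=0\}$. *)

theory Defs
  imports "HOL-Analysis.Analysis"
begin

text \<open>Regularity of the pencil sE - A: the determinant det(sE - A), as a function of s,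
  is not identically zero (equivalently, not the zero polynomial, since it is a polynomial in s).\<close>
definition regular_pencil :: "real^'n^'n \<Rightarrow> real^'n^'n \<Rightarrow> bool" where
  "regular_pencil E A \<longleftrightarrow> (\<lambda>s::real. det (s *\<^sub>R E - A)) \<noteq> (\<lambda>s. 0)"

text \<open>C-infinity functions R -> R^n: there is a sequence of successive derivatives.\<close>
definition smooth_fun :: "(real \<Rightarrow> real^'n) \<Rightarrow> bool" where
  "smooth_fun x \<longleftrightarrow> (\<exists>D :: nat \<Rightarrow> real \<Rightarrow> real^'n. D 0 = x \<and>
      (\<forall>k t. (D k has_vector_derivative D (Suc k) t) (at t)))"

text \<open>[E,A] is stable: every smooth solution of d/dt (E x) = A x is bounded on [0,\<infinity>).\<close>
definition stable_DAE :: "real^'n^'n \<Rightarrow> real^'n^'n \<Rightarrow> bool" where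
  "stable_DAE E A \<longleftrightarrow> (\<forall>x. smooth_fun x \<longrightarrow>
      (\<forall>t. ((\<lambda>t. E *v x t) has_vector_derivative (A *v x t)) (at t)) \<longrightarrow>
      bounded (x ` {0..}))"

definition psd :: "real^'n^'n \<Rightarrow> bool" where
  "psd M \<longleftrightarrow> (\<forall>v. 0 \<le> v \<bullet> (M *v v))"

definition mat_ker :: "real^'n^'n \<Rightarrow> (real^'n) set" where
  "mat_ker M = {v. M *v v = 0}"

end

(* The Hamiltonian H x = x \<bullet> (Q^T E x) decreases along every solution of (E x)' = (J - R) Q x,
   since its derivative is 2 (Q x) \<bullet> ((J - R) Q x) = -2 (Q x) \<bullet> (R Q x) \<le> 0.  The derivative x'
   solves the same equation, so H x and H x' stay bounded, and because Q^T E is positive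
   semidefinite so do Q^T E x and Q^T E x' = Q^T (J - R) Q x.  If ker E and ker ((J - R) Q) meet
   only in 0, these two vectors control x.  Conversely, a common kernel vector v yields the
   unbounded solution t v.  For w = Q v, (J - R) w = 0 forces w \<bullet> R w = 0 and hence J w = R w = 0,
   which identifies the common kernel with the set in the statement.  Part (a) holds because a
   kernel vector of Q lies in the kernel of every s E - Q. *)

theory Submission
  imports Defs
begin

lemma invertible_iff_ker_trivial:
  fixes A :: "'a::field^'n^'n"
  shows "invertible A \<longleftrightarrow> (\<forall>x. A *v x = 0 \<longrightarrow> x = 0)"
  by (metis invertible_left_inverse matrix_left_invertible_ker)

lemma inner_matrix_vector_transpose:
  fixes A :: "real^'n^'m"
  shows "x \<bullet> (A *v y) = (transpose A *v x) \<bullet> y"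
  by (metis dot_lmul_matrix vector_transpose_matrix transpose_transpose)

lemma matrix_vector_mult_uminus_left:
  fixes A :: "'a::comm_ring_1^'n^'m"
  shows "(- A) *v x = - (A *v x)"
  by (simp add: matrix_vector_mult_def sum_negf vec_eq_iff)

lemma skew_quadratic_form_eq_0:
  fixes J :: "real^'n^'n"
  assumes "J = - transpose J"
  shows "w \<bullet> (J *v w) = 0"
proof -
  have "w \<bullet> (J *v w) = - (w \<bullet> (transpose J *v w))"
    by (subst assms) (simp add: matrix_vector_mult_uminus_left)
  also have "\<dots> = - (w \<bullet> (J *v w))"
    by (simp add: inner_matrix_vector_transpose inner_commute)
  finally show ?thesis by simp
qed

lemma psd_cauchy_schwarz:
  fixes S :: "real^'n^'n"
  assumes "transpose S = S" and "psd S"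
  shows "(u \<bullet> (S *v v))\<^sup>2 \<le> (u \<bullet> (S *v u)) * (v \<bullet> (S *v v))"
proof -
  define a b c where "a = u \<bullet> (S *v u)" and "b = u \<bullet> (S *v v)" and "c = v \<bullet> (S *v v)"
  have quadratic_nonneg: "0 \<le> a + 2 * t * b + t\<^sup>2 * c" for t
  proof -
    have "v \<bullet> (S *v u) = b"
      using assms(1) by (metis b_def inner_commute inner_matrix_vector_transpose)
    moreover have "0 \<le> (u + t *\<^sub>R v) \<bullet> (S *v (u + t *\<^sub>R v))"
      using assms(2) psd_def by blast
    ultimately show ?thesis
      by (simp add: a_def b_def c_def matrix_vector_right_distrib matrix_vector_mult_scaleR
          inner_add_left inner_add_right algebra_simps power2_eq_square)
  qed
  have "0 \<le> a" "0 \<le> c"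
    using assms(2) by (simp_all add: a_def c_def psd_def)
  show ?thesis
  proof (cases "c = 0")
    case True
    have "b = 0"
    proof (rule ccontr)
      assume "b \<noteq> 0"
      \<comment> \<open>then the quadratic is affine in t and takes the value -1 at this t\<close>
      with True quadratic_nonneg[of "- (a + 1) / (2 * b)"] show False
        by (simp add: field_simps)
    qed
    with True show ?thesis by (simp add: a_def [symmetric] b_def [symmetric] c_def [symmetric])
  next
    case False
    with \<open>0 \<le> c\<close> have "0 < c" by simp
    with quadratic_nonneg[of "- b / c"] have "b\<^sup>2 \<le> a * c"
      by (simp add: field_simps power2_eq_square)
    then show ?thesis by (simp add: a_def b_def c_def)
  qed
qed

lemma psd_quadratic_form_eq_0_imp:
  fixes S :: "real^'n^'n"
  assumes "transpose S = S" and "psd S" and "w \<bullet> (S *v w) = 0"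
  shows "S *v w = 0"
proof -
  have "((S *v w) \<bullet> (S *v w))\<^sup>2 \<le> 0"
    using psd_cauchy_schwarz[OF assms(1,2), of "S *v w" w] assms(3) by simp
  then show ?thesis by simp
qed

lemma psd_norm_sq_le:
  fixes S :: "real^'n^'n"
  assumes "transpose S = S" and "psd S"
  obtains K where "K > 0" and "\<And>v. (norm (S *v v))\<^sup>2 \<le> K * (v \<bullet> (S *v v))"
proof -
  obtain K where K: "\<And>x. norm (S *v x) \<le> norm x * K" and "K > 0"
    using bounded_linear.pos_bounded[OF matrix_vector_mul_bounded_linear] by blast
  have "(norm (S *v v))\<^sup>2 \<le> K * (v \<bullet> (S *v v))" for v
  proof -
    define u where "u = S *v v"
    have "u \<bullet> (S *v u) \<le> K * (norm u)\<^sup>2"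
      using norm_cauchy_schwarz[of u "S *v u"] mult_left_mono[OF K[of u] norm_ge_zero[of u]]
      by (simp add: power2_eq_square algebra_simps)
    then have "(u \<bullet> (S *v u)) * (v \<bullet> (S *v v)) \<le> K * (norm u)\<^sup>2 * (v \<bullet> (S *v v))"
      using assms(2) by (simp add: mult_right_mono psd_def)
    moreover have "u \<bullet> (S *v v) = (norm u)\<^sup>2"
      by (simp add: u_def power2_norm_eq_inner)
    ultimately have le: "(norm u)\<^sup>2 * (norm u)\<^sup>2 \<le> (norm u)\<^sup>2 * (K * (v \<bullet> (S *v v)))"
      using psd_cauchy_schwarz[OF assms, of u v] by (simp add: power2_eq_square algebra_simps)
    have "(norm u)\<^sup>2 \<le> K * (v \<bullet> (S *v v))"
    proof (cases "u = 0")
      case True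
      with \<open>K > 0\<close> assms(2) show ?thesis by (simp add: psd_def)
    next
      case False
      then have "0 < (norm u)\<^sup>2" by simp
      with le show ?thesis by (simp only: mult_le_cancel_left_pos)
    qed
    then show ?thesis by (simp add: u_def)
  qed
  with \<open>K > 0\<close> show ?thesis using that by blast
qed

lemma skew_minus_psd_ker:
  fixes J R :: "real^'n^'n"
  assumes "J = - transpose J" and "transpose R = R" and "psd R"
    and "(J - R) *v w = 0"
  shows "J *v w = 0" and "R *v w = 0"
proof -
  have "w \<bullet> (R *v w) = w \<bullet> (J *v w) - w \<bullet> ((J - R) *v w)"
    by (simp add: matrix_vector_mult_diff_rdistrib inner_diff_right)
  then have "w \<bullet> (R *v w) = 0"
    using assms(4) skew_quadratic_form_eq_0[OF assms(1)] by simp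
  then show "R *v w = 0"
    by (rule psd_quadratic_form_eq_0_imp[OF assms(2,3)])
  then show "J *v w = 0"
    using assms(4) by (simp add: matrix_vector_mult_diff_rdistrib)
qed

lemma regular_pencil_imp_invertible:
  fixes E Q :: "real^'n^'n"
  assumes "mat_ker Q \<subseteq> mat_ker E" and "regular_pencil E Q"
  shows "invertible Q"
proof (rule ccontr)
  assume "\<not> invertible Q"
  then obtain v where "v \<noteq> 0" and "Q *v v = 0"
    using invertible_iff_ker_trivial by blast
  with assms(1) have "(s *\<^sub>R E - Q) *v v = 0" for s
    by (auto simp: mat_ker_def matrix_vector_mult_diff_rdistrib scaleR_matrix_vector_assoc[symmetric])
  with \<open>v \<noteq> 0\<close> have "det (s *\<^sub>R E - Q) = 0" for s
    by (meson invertible_det_nz invertible_iff_ker_trivial)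
  with assms(2) show False
    by (simp add: regular_pencil_def)
qed

lemma stable_DAE_imp_ker_inter_trivial:
  fixes E A :: "real^'n^'n"
  assumes "stable_DAE E A"
  shows "mat_ker E \<inter> mat_ker A = {0}"
proof -
  have "v = 0" if "E *v v = 0" and "A *v v = 0" for v
  proof -
    define x where "x = (\<lambda>t::real. t *\<^sub>R v)"
    define D where "D k = (if k = 0 then x else if k = 1 then (\<lambda>t. v) else (\<lambda>t. 0))"
      for k :: nat
    have "(D k has_vector_derivative D (Suc k) t) (at t)" for k t
      by (cases "k = 0") (auto simp: D_def x_def intro!: derivative_eq_intros)
    then have "smooth_fun x"
      unfolding smooth_fun_def by (intro exI[of _ D]) (simp add: D_def)
    moreover have "((\<lambda>t. E *v x t) has_vector_derivative A *v x t) (at t)" for t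
      using that by (simp add: x_def matrix_vector_mult_scaleR)
    ultimately have "bounded (x ` {0..})"
      using assms unfolding stable_DAE_def by blast
    then obtain a where a: "\<And>t. 0 \<le> t \<Longrightarrow> \<bar>t\<bar> * norm v \<le> a"
      unfolding bounded_iff x_def by auto
    show "v = 0"
    proof (rule ccontr)
      assume "v \<noteq> 0"
      with a[of "(\<bar>a\<bar> + 1) / norm v"] show False by simp
    qed
  qed
  then show ?thesis
    by (auto simp: mat_ker_def)
qed

lemma DAE_derivative_eq:
  fixes E A :: "real^'n^'n"
  assumes "(x has_vector_derivative x') (at t)"
    and "((\<lambda>t. E *v x t) has_vector_derivative A *v x t) (at t)"
  shows "E *v x' = A *v x t"
  using vector_derivative_unique_at[OF
      bounded_linear.has_vector_derivative[OF matrix_vector_mul_bounded_linear assms(1)] assms(2)] .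

lemma DAE_derivative_solves:
  fixes E A :: "real^'n^'n"
  assumes "\<And>t. (x has_vector_derivative x' t) (at t)"
    and "\<And>t. ((\<lambda>t. E *v x t) has_vector_derivative A *v x t) (at t)"
  shows "((\<lambda>t. E *v x' t) has_vector_derivative A *v x' t) (at t)"
proof -
  have "(\<lambda>t. E *v x' t) = (\<lambda>t. A *v x t)"
    using DAE_derivative_eq[OF assms(1,2)] by blast
  then show ?thesis
    using bounded_linear.has_vector_derivative[OF matrix_vector_mul_bounded_linear assms(1)] by simp
qed

lemma smooth_DAE_solution_derivatives:
  fixes E A :: "real^'n^'n"
  assumes "smooth_fun x" and "\<And>t. ((\<lambda>t. E *v x t) has_vector_derivative A *v x t) (at t)"
  obtains x' x'' where "\<And>t. (x has_vector_derivative x' t) (at t)"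
    and "\<And>t. (x' has_vector_derivative x'' t) (at t)"
    and "\<And>t. E *v x' t = A *v x t" and "\<And>t. E *v x'' t = A *v x' t"
proof -
  obtain D where "D 0 = x" and D: "\<And>k t. (D k has_vector_derivative D (Suc k) t) (at t)"
    using assms(1) unfolding smooth_fun_def by blast
  have x': "\<And>t. (x has_vector_derivative D 1 t) (at t)"
    using D[of 0] \<open>D 0 = x\<close> by simp
  have x'': "\<And>t. (D 1 has_vector_derivative D 2 t) (at t)"
    using D[of 1] by (simp add: numeral_2_eq_2)
  show ?thesis
    using that[OF x' x'' DAE_derivative_eq[OF x' assms(2)]
        DAE_derivative_eq[OF x'' DAE_derivative_solves[OF x' assms(2)]]] .
qed

lemma port_Hamiltonian_energy_nonincreasing:
  fixes E J R Q :: "real^'n^'n"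
  assumes "J = - transpose J" and "psd R"
    and "transpose Q ** E = transpose E ** Q"
    and "\<And>t. (y has_vector_derivative y' t) (at t)"
    and "\<And>t. E *v y' t = ((J - R) ** Q) *v y t"
    and "0 \<le> t"
  shows "y t \<bullet> ((transpose Q ** E) *v y t) \<le> y 0 \<bullet> ((transpose Q ** E) *v y 0)"
proof -
  define S where "S = transpose Q ** E"
  define H where "H s = y s \<bullet> (S *v y s)" for s
  have "(H has_real_derivative 2 * ((Q *v y s) \<bullet> ((J - R) *v (Q *v y s)))) (at s)" for s
  proof -
    have "((\<lambda>s. S *v y s) has_vector_derivative S *v y' s) (at s)"
      by (rule bounded_linear.has_vector_derivative[OF matrix_vector_mul_bounded_linear assms(4)])
    from bounded_bilinear.has_vector_derivative[OF bounded_bilinear_inner assms(4) this]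
    have "(H has_real_derivative y s \<bullet> (S *v y' s) + y' s \<bullet> (S *v y s)) (at s)"
      unfolding H_def has_real_derivative_iff_has_vector_derivative by simp
    moreover have "y' s \<bullet> (S *v y s) = y s \<bullet> (S *v y' s)"
      using assms(3) by (metis S_def inner_commute inner_matrix_vector_transpose matrix_transpose_mul
          transpose_transpose)
    moreover have "y s \<bullet> (S *v y' s) = (Q *v y s) \<bullet> (E *v y' s)"
      using inner_matrix_vector_transpose[of "y s" "transpose Q" "E *v y' s"]
      by (simp add: S_def matrix_vector_mul_assoc)
    moreover have "E *v y' s = (J - R) *v (Q *v y s)"
      by (simp add: assms(5) matrix_vector_mul_assoc)
    ultimately show ?thesis by simp
  qed
  moreover have "(Q *v y s) \<bullet> ((J - R) *v (Q *v y s)) \<le> 0" for s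
    using skew_quadratic_form_eq_0[OF assms(1)] assms(2)
    by (simp add: psd_def matrix_vector_mult_diff_rdistrib inner_diff_right)
  ultimately have "H t \<le> H 0"
    by (intro DERIV_nonpos_imp_nonincreasing[OF assms(6)]) (meson mult_le_0_iff zero_le_numeral)
  then show ?thesis by (simp add: H_def S_def)
qed

lemma port_Hamiltonian_energy_image_bounded:
  fixes E J R Q :: "real^'n^'n"
  assumes "J = - transpose J" and "psd R"
    and "transpose Q ** E = transpose E ** Q" and "psd (transpose Q ** E)"
    and "\<And>t. (y has_vector_derivative y' t) (at t)"
    and "\<And>t. E *v y' t = ((J - R) ** Q) *v y t"
  shows "bounded ((\<lambda>t. (transpose Q ** E) *v y t) ` {0..})"
proof -
  define S where "S = transpose Q ** E"
  have "transpose S = S"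
    using assms(3) by (simp add: S_def matrix_transpose_mul)
  then obtain C where "C > 0" and C: "\<And>v. (norm (S *v v))\<^sup>2 \<le> C * (v \<bullet> (S *v v))"
    using psd_norm_sq_le assms(4) S_def by blast
  have "norm (S *v y t) \<le> sqrt (C * (y 0 \<bullet> (S *v y 0)))" if "0 \<le> t" for t
  proof (rule real_le_rsqrt)
    have "y t \<bullet> (S *v y t) \<le> y 0 \<bullet> (S *v y 0)"
      unfolding S_def by (rule port_Hamiltonian_energy_nonincreasing[OF assms(1,2,3,5,6) that])
    with C[of "y t"] \<open>C > 0\<close> show "(norm (S *v y t))\<^sup>2 \<le> C * (y 0 \<bullet> (S *v y 0))"
      by (meson mult_left_mono order_trans less_imp_le)
  qed
  then show ?thesis
    unfolding bounded_iff S_def by auto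
qed

lemma matrix_pair_bounded_below:
  fixes A :: "real^'n^'m" and B :: "real^'n^'k"
  assumes "\<And>z. A *v z = 0 \<Longrightarrow> B *v z = 0 \<Longrightarrow> z = 0"
  obtains e where "e > 0" and "\<And>z. e * norm z \<le> norm (A *v z) + norm (B *v z)"
proof -
  let ?f = "\<lambda>z. (A *v z, B *v z)"
  have "bounded_linear ?f"
    by (intro bounded_linear_Pair matrix_vector_mul_bounded_linear)
  moreover have "\<forall>z\<in>UNIV. ?f z = 0 \<longrightarrow> z = 0"
    using assms by (simp add: zero_prod_def)
  ultimately obtain e where "e > 0" and "\<And>z. e * norm z \<le> norm (?f z)"
    using injective_imp_isometric[OF closed_UNIV subspace_UNIV] by blast
  show ?thesis
  proof (rule that[OF \<open>e > 0\<close>])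
    fix z
    show "e * norm z \<le> norm (A *v z) + norm (B *v z)"
      using \<open>\<And>z. e * norm z \<le> norm (?f z)\<close>[of z] norm_Pair_le[of "A *v z" "B *v z"] by linarith
  qed
qed

lemma stable_DAE_port_Hamiltonian:
  fixes E J R Q :: "real^'n^'n"
  assumes "J = - transpose J" and "psd R"
    and "transpose Q ** E = transpose E ** Q" and "psd (transpose Q ** E)"
    and "invertible Q"
    and "mat_ker E \<inter> mat_ker ((J - R) ** Q) = {0}"
  shows "stable_DAE E ((J - R) ** Q)"
  unfolding stable_DAE_def
proof (intro allI impI)
  define S M where "S = transpose Q ** E" and "M = (J - R) ** Q"
  fix x :: "real \<Rightarrow> real^'n"
  assume "smooth_fun x" and "\<forall>t. ((\<lambda>t. E *v x t) has_vector_derivative M *v x t) (at t)"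
  then obtain x' x'' where x': "\<And>t. (x has_vector_derivative x' t) (at t)"
    and x'': "\<And>t. (x' has_vector_derivative x'' t) (at t)"
    and x'_eq: "\<And>t. E *v x' t = M *v x t" and x''_eq: "\<And>t. E *v x'' t = M *v x' t"
    unfolding M_def by (metis smooth_DAE_solution_derivatives)
  have "bounded ((\<lambda>t. S *v x t) ` {0..})"
    unfolding S_def
    by (rule port_Hamiltonian_energy_image_bounded[OF assms(1-4) x' x'_eq[unfolded M_def]])
  moreover have "bounded ((\<lambda>t. S *v x' t) ` {0..})"
    unfolding S_def
    by (rule port_Hamiltonian_energy_image_bounded[OF assms(1-4) x'' x''_eq[unfolded M_def]])
  ultimately obtain a b where a: "\<And>t. 0 \<le> t \<Longrightarrow> norm (S *v x t) \<le> a"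
    and b: "\<And>t. 0 \<le> t \<Longrightarrow> norm (S *v x' t) \<le> b"
    unfolding bounded_iff by auto
  have "z = 0" if "S *v z = 0" and "(transpose Q ** M) *v z = 0" for z
  proof -
    have "\<And>w. transpose Q *v w = 0 \<Longrightarrow> w = 0"
      using transpose_invertible[OF assms(5)] invertible_iff_ker_trivial by blast
    then have "E *v z = 0" and "M *v z = 0"
      using that by (simp_all add: S_def matrix_vector_mul_assoc[symmetric])
    with assms(6) show "z = 0"
      by (auto simp: M_def mat_ker_def)
  qed
  then obtain e where "e > 0" and e: "\<And>z. e * norm z \<le> norm (S *v z) + norm ((transpose Q ** M) *v z)"
    using matrix_pair_bounded_below by blast
  have "(transpose Q ** M) *v x t = S *v x' t" for t
    unfolding S_def matrix_vector_mul_assoc[symmetric] x'_eq by (rule refl)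
  then have "e * norm (x t) \<le> a + b" if "0 \<le> t" for t
    using e[of "x t"] a[OF that] b[OF that] by simp
  with \<open>e > 0\<close> have "norm (x t) \<le> (a + b) / e" if "0 \<le> t" for t
    using that by (simp add: pos_le_divide_eq mult.commute)
  then show "bounded (x ` {0..})"
    unfolding bounded_iff by auto
qed

lemma skew_minus_psd_ker_image:
  fixes E J R Q :: "real^'n^'n"
  assumes "J = - transpose J" and "transpose R = R" and "psd R"
  shows "mat_ker J \<inter> mat_ker R \<inter> ((*v) Q ` mat_ker E)
    = (*v) Q ` (mat_ker E \<inter> mat_ker ((J - R) ** Q))"
proof -
  have "J *v w = 0 \<and> R *v w = 0 \<longleftrightarrow> (J - R) *v w = 0" for w
  proof
    assume "(J - R) *v w = 0"
    with skew_minus_psd_ker[OF assms] show "J *v w = 0 \<and> R *v w = 0" by blast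
  qed (simp add: matrix_vector_mult_diff_rdistrib)
  then have "Q *v v \<in> mat_ker J \<inter> mat_ker R \<longleftrightarrow> v \<in> mat_ker ((J - R) ** Q)" for v
    by (simp add: mat_ker_def matrix_vector_mul_assoc[symmetric])
  then show ?thesis
    by blast
qed

lemma invertible_image_eq_0_iff:
  fixes Q :: "'a::field^'n^'n"
  assumes "invertible Q" and "0 \<in> N"
  shows "(*v) Q ` N = {0} \<longleftrightarrow> N = {0}"
proof
  assume image_0: "(*v) Q ` N = {0}"
  show "N = {0}"
  proof (intro equalityI subsetI)
    fix v
    assume "v \<in> N"
    with image_0 have "Q *v v = 0"
      by (metis image_eqI singletonD)
    with assms(1) show "v \<in> {0}"
      by (simp add: invertible_iff_ker_trivial)
  qed (simp add: assms(2))
qed simp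

theorem proposition4:
  fixes E J R Q :: "real^'n^'n"
  assumes "J = - transpose J"
    and "R = transpose R" and "psd R"
    and "transpose Q ** E = transpose E ** Q" and "psd (transpose Q ** E)"
    and "mat_ker Q \<subseteq> mat_ker E"
  shows "(regular_pencil E Q \<longrightarrow> invertible Q)
    \<and> (invertible Q \<longrightarrow>
         (stable_DAE E ((J - R) ** Q) \<longleftrightarrow>
          mat_ker J \<inter> mat_ker R \<inter> ((*v) Q ` mat_ker E) = {0}))"
proof (intro conjI impI)
  show "invertible Q" if "regular_pencil E Q"
    using regular_pencil_imp_invertible[OF assms(6) that] .
next
  assume "invertible Q"
  let ?N = "mat_ker E \<inter> mat_ker ((J - R) ** Q)"
  have "mat_ker J \<inter> mat_ker R \<inter> ((*v) Q ` mat_ker E) = (*v) Q ` ?N"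
    using assms(1,3) by (intro skew_minus_psd_ker_image) (simp_all add: assms(2)[symmetric])
  also have "\<dots> = {0} \<longleftrightarrow> ?N = {0}"
    using \<open>invertible Q\<close> by (rule invertible_image_eq_0_iff) (simp add: mat_ker_def)
  finally have ker_iff: "mat_ker J \<inter> mat_ker R \<inter> ((*v) Q ` mat_ker E) = {0} \<longleftrightarrow> ?N = {0}" .
  show "stable_DAE E ((J - R) ** Q) \<longleftrightarrow> mat_ker J \<inter> mat_ker R \<inter> ((*v) Q ` mat_ker E) = {0}"
  proof
    assume "stable_DAE E ((J - R) ** Q)"
    then have "?N = {0}"
      by (rule stable_DAE_imp_ker_inter_trivial)
    then show "mat_ker J \<inter> mat_ker R \<inter> ((*v) Q ` mat_ker E) = {0}"
      by (rule ker_iff[THEN iffD2])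
  next
    assume "mat_ker J \<inter> mat_ker R \<inter> ((*v) Q ` mat_ker E) = {0}"
    then have "?N = {0}"
      by (rule ker_iff[THEN iffD1])
    then show "stable_DAE E ((J - R) ** Q)"
      by (rule stable_DAE_port_Hamiltonian[OF assms(1,3,4,5) \<open>invertible Q\<close>])
  qed
qed

end
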